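(* Let $n\ge5$ and $q$ be integers with $0<q<n/2$ and $\gcd(q,n)=1$, let $\varepsilon\in[0,1)$, $u_0\in\mathbb{R}$, $\omega=q/n$, $h=4K(\varepsilon)\omega$, let $p(u)=[\operatorname{sn}(u):\operatorname{cn}(u):1]$, and let $P(u_0)$ be the labeled $n$-gon with vertices $P(u_0)_i=p(u_0+ih)$ (indices modulo $n$). Put $$s_x=\frac{\operatorname{cn}(h)\operatorname{dn}(h/2)}{\operatorname{dn}(h)\operatorname{cn}(h/2)}=\frac{\operatorname{cd}(h)}{\operatorname{cd}(h/2)},\qquad s_y=\frac{\operatorname{cn}(h)}{\operatorname{cn}(h/2)},\qquad S=\operatorname{diag}(s_x,s_y,1).$$ Then $$T(P(u_0))_i=S\,p\!\left(u_0+\left(i+\tfrac32\right)h\right),$$ and consequently $T^2(P(u_0))_i=S^2P(u_0)_{i+3}$. Thus, in this labeling convention, the projectivity $G$ with $T^2(P(u_0))=\Sigma_3(G(P(u_0)))$ (the forward Darboux–Schwartz projectivity) has a lift $$G=S^2=\operatorname{diag}(a,b,1),\qquad a=\left(\frac{\operatorname{cd}(h)}{\operatorname{cd}(h/2)}\right)^2,\quad b=\left(\frac{\operatorname{cn}(h)}{\operatorname{cn}(h/2)}\right)^2,$$ and in particular $\operatorname{Spec}(G)=\{1,a,b\}$. For $0<\varepsilon<1$ the ordering depends only on $\omega$: $$0<\omega<\tfrac13\ \Rightarrow\ 1>a>b>0;\qquad \omega=\tfrac13\ \Rightarrow\ a=b=1;\qquad \tfrac13<\omega<\tfrac12\ \Rightarrow\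 b>a>1.$$ (The value $\omega=1/3$, and the value $\omega=1/4$ for which the formulas give $a=b=0$, have reduced denominators $3$ and $4$ and do not occur under the assumptions $n\ge5$, $\gcd(q,n)=1$; the assertions about them concern the formulas for $a,b$.) Thus the spectrum of $G$ is positive and simple for $0<\varepsilon<1$. For $\varepsilon=0$ (the projectively regular boundary) the two non-unit eigenvalues coincide; they are subdominant (smaller than $1$) when $0<\omega<1/3$ and dominant (larger than $1$) when $1/3<\omega<1/2$.
   Context: $\operatorname{sn},\operatorname{cn},\operatorname{dn}$ are the Jacobi elliptic functions with modulus $\varepsilon\in[0,1)$ (the modulus is suppressed), $\operatorname{cd}=\operatorname{cn}/\operatorname{dn}$, and $K(\varepsilon)=\int_0^{\pi/2}\frac{d\theta}{\sqrt{1-\varepsilon^2\sin^2\theta}}$. The points $p(u_0+ih)$ lie on the unit circle and are $n$-periodic in $i$. $\mathbb{R}^2\subset\mathbb{RP}^2$ via $(x,y)\mapsto[x:y:1]$. For a labeled $n$-gon $P=(p_i)$ (indices modulo $n$) the pentagram map is $T(P)_i=(p_ip_{i+2})\cap(p_{i+1}p_{i+3})$, and $\Sigma_s(P)_i=p_{i+s}$. A $3\times3$ invertible matrix acts on points of $\mathbb{RP}^2$ and on polygons vertexwise. *)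

theory Defs
  imports "HOL-Analysis.Analysis"
begin

section \<open>Jacobi elliptic functions of a real argument, with modulus k\<close>

text \<open>For a negative upper bound the integral is the oriented one, so \<open>ellipticF k\<close> is odd.\<close>

definition ellipticF :: "real \<Rightarrow> real \<Rightarrow> real" where
  "ellipticF k \<phi> = (LBINT \<theta>=ereal 0..ereal \<phi>. 1 / sqrt (1 - k\<^sup>2 * (sin \<theta>)\<^sup>2))"

definition ellipticK :: "real \<Rightarrow> real" where
  "ellipticK k = (LBINT \<theta>=ereal 0..ereal (pi / 2). 1 / sqrt (1 - k\<^sup>2 * (sin \<theta>)\<^sup>2))"

text \<open>For \<open>0 \<le> k < 1\<close> the map \<open>ellipticF k\<close> is an increasing bijection of the real line; the
  amplitude is its inverse.\<close>

definition jacobi_am :: "real \<Rightarrow> real \<Rightarrow> real" where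
  "jacobi_am k u = (THE \<phi>. ellipticF k \<phi> = u)"

definition sn :: "real \<Rightarrow> real \<Rightarrow> real" where
  "sn k u = sin (jacobi_am k u)"

definition cn :: "real \<Rightarrow> real \<Rightarrow> real" where
  "cn k u = cos (jacobi_am k u)"

definition dn :: "real \<Rightarrow> real \<Rightarrow> real" where
  "dn k u = sqrt (1 - k\<^sup>2 * (sn k u)\<^sup>2)"

definition cd :: "real \<Rightarrow> real \<Rightarrow> real" where
  "cd k u = cn k u / dn k u"


section \<open>The real projective plane and the pentagram map\<close>

text \<open>A point of the projective plane is a one-dimensional subspace of \<open>real ^ 3\<close>; a projective
  line is a two-dimensional subspace.  Hence the line through two distinct points is the span of
  their union, and the common point of two distinct lines is their intersection.\<close>

definition RP2 :: "(real ^ 3) set set" where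
  "RP2 = {V. subspace V \<and> dim V = 1}"

definition proj_point :: "real \<Rightarrow> real \<Rightarrow> real \<Rightarrow> (real ^ 3) set" where
  "proj_point x y z = span {vector [x, y, z]}"

definition join :: "(real ^ 3) set \<Rightarrow> (real ^ 3) set \<Rightarrow> (real ^ 3) set" where
  "join A B = span (A \<union> B)"

text \<open>Labels are integers modulo \<open>n\<close>, so a labeled \<open>n\<close>-gon is an \<open>n\<close>-periodic family.\<close>

definition labeled_ngon :: "int \<Rightarrow> (int \<Rightarrow> (real ^ 3) set) \<Rightarrow> bool" where
  "labeled_ngon n P \<longleftrightarrow> (\<forall>i. P i \<in> RP2) \<and> (\<forall>i. P (i + n) = P i)"

definition pentagram :: "(int \<Rightarrow> (real ^ 3) set) \<Rightarrow> int \<Rightarrow> (real ^ 3) set" where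
  "pentagram P i = join (P i) (P (i + 2)) \<inter> join (P (i + 1)) (P (i + 3))"

text \<open>The construction is meaningful when the lines used are determined by their two points and
  intersecting lines are distinct.\<close>

definition pentagram_defined :: "(int \<Rightarrow> (real ^ 3) set) \<Rightarrow> bool" where
  "pentagram_defined P \<longleftrightarrow>
     (\<forall>i. P i \<noteq> P (i + 2) \<and> join (P i) (P (i + 2)) \<noteq> join (P (i + 1)) (P (i + 3)))"

definition relabel :: "int \<Rightarrow> (int \<Rightarrow> (real ^ 3) set) \<Rightarrow> int \<Rightarrow> (real ^ 3) set" where
  "relabel s P i = P (i + s)"

definition act :: "real ^ 3 ^ 3 \<Rightarrow> (real ^ 3) set \<Rightarrow> (real ^ 3) set" where
  "act M V = (\<lambda>v. M *v v) ` V"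

definition act_polygon :: "real ^ 3 ^ 3 \<Rightarrow> (int \<Rightarrow> (real ^ 3) set) \<Rightarrow> int \<Rightarrow> (real ^ 3) set" where
  "act_polygon M P i = act M (P i)"

definition diag3 :: "real \<Rightarrow> real \<Rightarrow> real \<Rightarrow> real ^ 3 ^ 3" where
  "diag3 x y z = (\<chi> i j. if i = j then vector [x, y, z] $ i else 0)"

text \<open>\<open>M\<close> is a lift (an invertible matrix) of a forward Darboux--Schwartz projectivity of \<open>P\<close>.\<close>

definition forward_DS_lift :: "(int \<Rightarrow> (real ^ 3) set) \<Rightarrow> real ^ 3 ^ 3 \<Rightarrow> bool" where
  "forward_DS_lift P M \<longleftrightarrow>
     invertible M \<and> pentagram (pentagram P) = relabel 3 (act_polygon M P)"


section \<open>Spectrum of a real matrix\<close>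

text \<open>The spectrum consists of all complex eigenvalues; it is simple if every eigenvalue has
  algebraic multiplicity one.\<close>

definition Spec :: "real ^ 'n ^ 'n \<Rightarrow> complex set" where
  "Spec A = {z. \<exists>v. v \<noteq> 0 \<and> map_matrix complex_of_real A *v v = z *s v}"

definition charpoly :: "complex ^ 'n ^ 'n \<Rightarrow> complex poly" where
  "charpoly A = det (\<chi> i j. (if i = j then [:0, 1:] else 0) - [:A $ i $ j:])"

definition simple_spectrum :: "real ^ 'n ^ 'n \<Rightarrow> bool" where
  "simple_spectrum A \<longleftrightarrow>
     (\<forall>z \<in> Spec A. order z (charpoly (map_matrix complex_of_real A)) = 1)"

definition positive_spectrum :: "real ^ 'n ^ 'n \<Rightarrow> bool" where
  "positive_spectrum A \<longleftrightarrow> (\<forall>z \<in> Spec A. \<exists>r > 0. z = complex_of_real r)"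


section \<open>The polygons and the scaling factors\<close>

definition circle_point :: "real \<Rightarrow> real \<Rightarrow> (real ^ 3) set" where
  "circle_point k u = proj_point (sn k u) (cn k u) 1"

definition poncelet_polygon :: "real \<Rightarrow> real \<Rightarrow> real \<Rightarrow> int \<Rightarrow> (real ^ 3) set" where
  "poncelet_polygon k h u0 i = circle_point k (u0 + of_int i * h)"

definition s_x :: "real \<Rightarrow> real \<Rightarrow> real" where
  "s_x k h = (cn k h * dn k (h / 2)) / (dn k h * cn k (h / 2))"

definition s_y :: "real \<Rightarrow> real \<Rightarrow> real" where
  "s_y k h = cn k h / cn k (h / 2)"

definition scaling :: "real \<Rightarrow> real \<Rightarrow> real ^ 3 ^ 3" where
  "scaling k h = diag3 (s_x k h) (s_y k h) 1"

definition eig_a :: "real \<Rightarrow> real \<Rightarrow> real" where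
  "eig_a k h = (cd k h / cd k (h / 2))\<^sup>2"

definition eig_b :: "real \<Rightarrow> real \<Rightarrow> real" where
  "eig_b k h = (cn k h / cn k (h / 2))\<^sup>2"

end

theory Submission
  imports Defs
begin

text \<open>
  Everything rests on one identity, \<open>dn w sn v sn (v \<plusminus> w) + cn v cn (v \<plusminus> w) = cn w\<close>, which says that
  the line \<open>dn w sn v x + cn v y = cn w\<close> is the chord through the circle points with parameters
  \<open>v - w\<close> and \<open>v + w\<close>.  The two short diagonals defining a vertex of the pentagram image have
  \<open>v = m \<plusminus> h/2\<close> and \<open>w = h\<close>, where \<open>m = u + (i + 3/2) h\<close>.  After the scaling \<open>S\<close> the condition that
  \<open>S p(m)\<close> lies on them becomes the same identity with \<open>w = h/2\<close>.  A projectivity is determined by its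
  values at four points of the circle, which gives the uniqueness of \<open>G\<close>.  The eigenvalues are
  monotone in \<open>sn\<^sup>2 h\<close> and \<open>sn\<^sup>2 (h/2)\<close>, and \<open>sn (h/2) < sn h\<close> holds exactly for \<open>h < 4K/3\<close>, by the
  symmetry of \<open>sn\<close> about \<open>K\<close>.
\<close>

section \<open>Jacobi elliptic functions\<close>

lemma isconst_if_deriv_zero:
  fixes f :: "real \<Rightarrow> real"
  assumes "\<And>x. (f has_real_derivative 0) (at x)"
  shows "f x = f y"
  using DERIV_isconst_all[of f x y] assms by blast

lemma quotient_deriv_zero:
  assumes "(f has_real_derivative f') (at x)" "(g has_real_derivative g') (at x)"
    and "f' * g x = f x * g'" and "g x \<noteq> 0"
  shows "((\<lambda>x. f x / g x) has_real_derivative 0) (at x)"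
  using DERIV_divide[OF assms(1,2,4)] assms(3) by simp

text \<open>This is the quotient-rule numerator in \<open>sn_add\<close>: the entries are the values
  at \<open>t\<close> and \<open>c - t\<close>, and \<open>K\<close> stands for
  \<open>k\<^sup>2\<close>. It holds because the right-hand side contains a difference of two
  squares.\<close>

lemma sn_add_identity:
  fixes s1 s2 c1 c2 d1 d2 K :: real
  assumes "s1\<^sup>2 + c1\<^sup>2 = 1" "s2\<^sup>2 + c2\<^sup>2 = 1" "d1\<^sup>2 = 1 - K * s1\<^sup>2" "d2\<^sup>2 = 1 - K * s2\<^sup>2"
  shows "2 * K * s1 * s2 * (s1\<^sup>2 - s2\<^sup>2) * (1 - K * s1\<^sup>2 * s2\<^sup>2)
   = (s1 * c2 * d2 + s2 * c1 * d1) * (- 2 * K * s1 * s2 * (c1 * d1 * s2 - s1 * c2 * d2))"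
proof -
  have "(s1\<^sup>2 - s2\<^sup>2) * (1 - K * s1\<^sup>2 * s2\<^sup>2) = (s1 * c2 * d2)\<^sup>2 - (s2 * c1 * d1)\<^sup>2"
  proof -
    have c: "c1\<^sup>2 = 1 - s1\<^sup>2" "c2\<^sup>2 = 1 - s2\<^sup>2" using assms by auto
    show ?thesis
      unfolding power_mult_distrib c assms(3,4) by (simp add: algebra_simps)
  qed
  then show ?thesis by algebra
qed

text \<open>The counterpart for \<open>cn_add\<close>. The denominator is written in two ways as a
  sum of two squares, one for each term in the derivative of the numerator.\<close>

lemma cn_add_identity:
  fixes s1 s2 c1 c2 d1 d2 K :: real
  assumes "s1\<^sup>2 + c1\<^sup>2 = 1" "s2\<^sup>2 + c2\<^sup>2 = 1" "d1\<^sup>2 = 1 - K * s1\<^sup>2" "d2\<^sup>2 = 1 - K * s2\<^sup>2"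
  shows "2 * K * s1 * s2 * (s1 * c1 * d2 - s2 * c2 * d1) * (1 - K * s1\<^sup>2 * s2\<^sup>2)
   = (c1 * c2 - s1 * s2 * d1 * d2) * (- 2 * K * s1 * s2 * (c1 * d1 * s2 - s1 * c2 * d2))"
proof -
  have "c2\<^sup>2 + s2\<^sup>2 * d1\<^sup>2 = 1 - K * s1\<^sup>2 * s2\<^sup>2" "c1\<^sup>2 + s1\<^sup>2 * d2\<^sup>2 = 1 - K * s1\<^sup>2 * s2\<^sup>2"
    using assms by algebra+
  then show ?thesis by algebra
qed

section \<open>The incomplete elliptic integral and its inverse, the amplitude\<close>

context
  fixes k :: real
  assumes k: "k\<^sup>2 < 1"
begin

lemma modulus_sin_less: "k\<^sup>2 * (sin x)\<^sup>2 < 1"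
proof -
  have "k\<^sup>2 * (sin x)\<^sup>2 \<le> k\<^sup>2 * 1"
    by (intro mult_left_mono) (auto simp: abs_square_le_1)
  with k show ?thesis by linarith
qed

lemma ellipticF_deriv:
  "(ellipticF k has_real_derivative 1 / sqrt (1 - k\<^sup>2 * (sin x)\<^sup>2)) (at x)"
proof -
  let ?f = "\<lambda>\<theta>. 1 / sqrt (1 - k\<^sup>2 * (sin \<theta>)\<^sup>2)"
  \<comment> \<open>The interval contains the base point 0 of the integral and has \<open>x\<close>
    in its interior, so the derivative within it is a two-sided one.\<close>
  define a b where "a = - \<bar>x\<bar> - 1" and "b = \<bar>x\<bar> + 1"
  have ab: "a < 0" "0 < b" "a < x" "x < b" by (auto simp: a_def b_def)
  have "1 - k\<^sup>2 * (sin \<theta>)\<^sup>2 > 0" for \<theta> using modulus_sin_less[of \<theta>] by simp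
  then have "continuous_on {a..b} ?f"
    by (intro continuous_intros) (auto simp: less_le)
  then have "((\<lambda>u. LBINT y=ereal 0..ereal u. ?f y) has_vector_derivative ?f x) (at x within {a..b})"
    using ab by (intro interval_integral_FTC2[of a 0 b]) auto
  then have "((\<lambda>u. LBINT y=ereal 0..ereal u. ?f y) has_vector_derivative ?f x) (at x within {a<..<b})"
    by (rule has_vector_derivative_within_subset) auto
  then have "((\<lambda>u. LBINT y=ereal 0..ereal u. ?f y) has_vector_derivative ?f x) (at x)"
    using ab by (metis at_within_open greaterThanLessThan_iff open_greaterThanLessThan)
  then show ?thesis
    by (simp add: ellipticF_def[abs_def] has_real_derivative_iff_has_vector_derivative)
qed

lemma ellipticF_0 [simp]: "ellipticF k 0 = 0"
  by (simp add: ellipticF_def)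

text \<open>The integrand is at least 1. Strict monotonicity, surjectivity and the Lipschitz bound
  for the amplitude all come from this.\<close>

lemma ellipticF_expanding:
  assumes "x \<le> y" shows "y - x \<le> ellipticF k y - ellipticF k x"
proof -
  have "((\<lambda>t. ellipticF k t - t) has_real_derivative 1 / sqrt (1 - k\<^sup>2 * (sin t)\<^sup>2) - 1) (at t)" for t
    by (intro DERIV_diff ellipticF_deriv DERIV_ident)
  moreover have "1 / sqrt (1 - k\<^sup>2 * (sin t)\<^sup>2) - 1 \<ge> 0" for t
  proof -
    have "sqrt (1 - k\<^sup>2 * (sin t)\<^sup>2) \<le> 1" "sqrt (1 - k\<^sup>2 * (sin t)\<^sup>2) > 0"
      using modulus_sin_less[of t] by auto
    then show ?thesis by simp
  qed
  ultimately have "ellipticF k x - x \<le> ellipticF k y - y"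
    by (intro DERIV_nonneg_imp_nondecreasing[OF assms] exI conjI)
  then show ?thesis by simp
qed

lemma ellipticF_less: "x < y \<Longrightarrow> ellipticF k x < ellipticF k y"
  using ellipticF_expanding[of x y] by simp

lemma ellipticF_less_iff: "ellipticF k x < ellipticF k y \<longleftrightarrow> x < y"
  using ellipticF_less[of x y] ellipticF_less[of y x] by (metis less_asym less_irrefl linorder_neqE)

lemma ellipticF_eq_iff: "ellipticF k x = ellipticF k y \<longleftrightarrow> x = y"
  using ellipticF_less_iff by (metis less_irrefl linorder_neqE)

lemma ellipticF_surj: "\<exists>x. ellipticF k x = u"
proof -
  have cont: "isCont (ellipticF k) x" for x using ellipticF_deriv DERIV_isCont by blast
  have "ellipticF k (- \<bar>u\<bar>) \<le> u" "u \<le> ellipticF k \<bar>u\<bar>"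
    using ellipticF_expanding[of "- \<bar>u\<bar>" 0] ellipticF_expanding[of 0 "\<bar>u\<bar>"] by auto
  then show ?thesis
    using IVT[of "ellipticF k" "- \<bar>u\<bar>" u "\<bar>u\<bar>"] cont by auto
qed

lemma jacobi_am_ellipticF [simp]: "jacobi_am k (ellipticF k x) = x"
  unfolding jacobi_am_def by (rule the_equality) (auto simp: ellipticF_eq_iff)

lemma ellipticF_jacobi_am [simp]: "ellipticF k (jacobi_am k u) = u"
  using ellipticF_surj[of u] jacobi_am_ellipticF by metis

lemma jacobi_am_less_iff: "jacobi_am k u < jacobi_am k v \<longleftrightarrow> u < v"
  using ellipticF_less_iff[of "jacobi_am k u" "jacobi_am k v"] by simp

lemma jacobi_am_eq_iff: "jacobi_am k u = jacobi_am k v \<longleftrightarrow> u = v"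
  using ellipticF_eq_iff[of "jacobi_am k u" "jacobi_am k v"] by simp

lemma jacobi_am_eqI: "ellipticF k x = u \<Longrightarrow> jacobi_am k u = x"
  using jacobi_am_ellipticF by blast

lemma ellipticF_minus: "ellipticF k (- x) = - ellipticF k x"
proof -
  have "((\<lambda>x. ellipticF k (- x) + ellipticF k x) has_real_derivative 0) (at x)" for x
    by (rule derivative_eq_intros DERIV_chain'[OF _ ellipticF_deriv] ellipticF_deriv refl)+ simp
  from isconst_if_deriv_zero[OF this, of x 0] show ?thesis by simp
qed

text \<open>Since sin (pi - x) = sin x, the sum of the values at \<open>x\<close> and
  \<open>pi - x\<close> has derivative zero; the constant is read off at the fixed point
  \<open>pi / 2\<close>.\<close>

lemma ellipticF_reflect: "ellipticF k (pi - x) = 2 * ellipticK k - ellipticF k x"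
proof -
  have "((\<lambda>x. ellipticF k (pi - x) + ellipticF k x) has_real_derivative 0) (at x)" for x
    by (rule derivative_eq_intros DERIV_chain'[OF _ ellipticF_deriv] ellipticF_deriv refl)+ simp
  from isconst_if_deriv_zero[OF this, of x "pi / 2"]
  have "ellipticF k (pi - x) + ellipticF k x = ellipticF k (pi - pi/2) + ellipticF k (pi / 2)" .
  also have "pi - pi / 2 = pi / 2" by simp
  also have "ellipticF k (pi / 2) = ellipticK k" by (simp add: ellipticF_def ellipticK_def)
  finally show ?thesis by simp
qed

lemma ellipticK_pos: "ellipticK k > 0"
  using ellipticF_less[of 0 pi] ellipticF_reflect[of 0] by simp

lemma jacobi_am_0 [simp]: "jacobi_am k 0 = 0"
  by (rule jacobi_am_eqI) simp

lemma jacobi_am_ellipticK: "jacobi_am k (ellipticK k) = pi / 2"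
  by (rule jacobi_am_eqI) (simp add: ellipticF_def ellipticK_def)

lemma jacobi_am_minus: "jacobi_am k (- u) = - jacobi_am k u"
  by (rule jacobi_am_eqI) (simp add: ellipticF_minus)

lemma jacobi_am_reflect: "jacobi_am k (2 * ellipticK k - u) = pi - jacobi_am k u"
  by (rule jacobi_am_eqI) (simp add: ellipticF_reflect)

text \<open>Reflection and oddness combine to a shift by \<open>2 * ellipticK k\<close> that adds
  \<open>pi\<close> to the amplitude; it is applied twice.\<close>

lemma jacobi_am_period: "jacobi_am k (u + 4 * ellipticK k) = jacobi_am k u + 2 * pi"
  using jacobi_am_reflect[of "- (2 * ellipticK k + u)"] jacobi_am_reflect[of "- u"]
    jacobi_am_minus[of "2 * ellipticK k + u"] jacobi_am_minus[of u]
  by (simp add: add.commute)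

lemma jacobi_am_period_int:
  "jacobi_am k (u + of_int m * (4 * ellipticK k)) = jacobi_am k u + of_int m * (2 * pi)"
proof (induction m rule: int_induct[where k = 0])
  case (step1 i)
  then show ?case
    using jacobi_am_period[of "u + of_int i * (4 * ellipticK k)"] by (simp add: algebra_simps)
next
  case (step2 i)
  then show ?case
    using jacobi_am_period[of "u + of_int (i - 1) * (4 * ellipticK k)"] by (simp add: algebra_simps)
qed simp

text \<open>The inverse of an expanding map is 1-Lipschitz. This supplies the continuity needed to
  differentiate the inverse.\<close>

lemma jacobi_am_dist: "\<bar>jacobi_am k u - jacobi_am k v\<bar> \<le> \<bar>u - v\<bar>"
  using ellipticF_expanding[of "jacobi_am k u" "jacobi_am k v"]
    ellipticF_expanding[of "jacobi_am k v" "jacobi_am k u"] by simp linarith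

lemma isCont_jacobi_am: "isCont (jacobi_am k) u"
  unfolding continuous_at_eps_delta
  using jacobi_am_dist by (auto simp: dist_real_def intro: le_less_trans)

section \<open>Derivatives of sn, cn and dn\<close>

lemma dn_pos: "dn k u > 0"
  using modulus_sin_less by (simp add: dn_def sn_def)

lemma dn_sq: "(dn k u)\<^sup>2 = 1 - k\<^sup>2 * (sn k u)\<^sup>2"
  using modulus_sin_less by (simp add: dn_def sn_def less_imp_le)

lemma sn_cn_sq: "(sn k u)\<^sup>2 + (cn k u)\<^sup>2 = 1"
  by (simp add: sn_def cn_def)

lemma jacobi_am_deriv: "(jacobi_am k has_real_derivative dn k u) (at u)"
proof -
  have "(jacobi_am k has_real_derivative
      inverse (1 / sqrt (1 - k\<^sup>2 * (sin (jacobi_am k u))\<^sup>2))) (at u)"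
    by (rule DERIV_inverse_function[where a = "u - 1" and b = "u + 1", OF ellipticF_deriv])
      (use dn_pos[of u] isCont_jacobi_am in \<open>auto simp: dn_def sn_def\<close>)
  then show ?thesis by (simp add: dn_def sn_def)
qed

lemma sn_deriv: "(sn k has_real_derivative cn k u * dn k u) (at u)"
  unfolding sn_def[abs_def] cn_def
  by (rule derivative_eq_intros jacobi_am_deriv refl)+

lemma cn_deriv: "(cn k has_real_derivative - (sn k u * dn k u)) (at u)"
  unfolding sn_def cn_def[abs_def]
  by (rule derivative_eq_intros jacobi_am_deriv refl)+ simp

lemma dn_deriv: "(dn k has_real_derivative - (k\<^sup>2 * sn k u * cn k u)) (at u)"
proof -
  have pos: "1 - k\<^sup>2 * (sn k u)\<^sup>2 > 0" using dn_pos[of u] by (simp add: dn_def)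
  have "((\<lambda>u. 1 - k\<^sup>2 * (sn k u)\<^sup>2) has_real_derivative
      - (2 * k\<^sup>2 * sn k u * cn k u * dn k u)) (at u)"
    apply (rule derivative_eq_intros sn_deriv refl)+
    apply simp
    done
  from DERIV_chain'[OF this DERIV_real_sqrt[OF pos]] show ?thesis
    using dn_pos[of u] unfolding dn_def[abs_def, symmetric]
    by (simp add: dn_def[symmetric] field_simps)
qed

lemma sn_0 [simp]: "sn k 0 = 0" and cn_0 [simp]: "cn k 0 = 1" and dn_0 [simp]: "dn k 0 = 1"
  by (simp_all add: sn_def cn_def dn_def)

lemma sn_minus [simp]: "sn k (- u) = - sn k u"
  and cn_minus [simp]: "cn k (- u) = cn k u"
  and dn_minus [simp]: "dn k (- u) = dn k u"
  by (simp_all add: sn_def cn_def dn_def jacobi_am_minus)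

section \<open>Addition theorems and the chord identity\<close>

lemma addition_denom_pos: "1 - k\<^sup>2 * (sn k u)\<^sup>2 * (sn k v)\<^sup>2 > 0"
proof -
  have "(sn k u)\<^sup>2 * (sn k v)\<^sup>2 \<le> 1 * 1"
    by (intro mult_mono) (auto simp: sn_def abs_square_le_1)
  then have "k\<^sup>2 * ((sn k u)\<^sup>2 * (sn k v)\<^sup>2) \<le> k\<^sup>2 * 1"
    by (intro mult_left_mono) auto
  with k show ?thesis by (simp add: mult.assoc)
qed

text \<open>With the sum \<open>c\<close> of the arguments held fixed, the right-hand side has
  derivative zero in \<open>u\<close>, and at \<open>u = 0\<close> it equals
  \<open>sn k c\<close>.\<close>

lemma sn_add:
  "sn k (u + v) = (sn k u * cn k v * dn k v + sn k v * cn k u * dn k u)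
     / (1 - k\<^sup>2 * (sn k u)\<^sup>2 * (sn k v)\<^sup>2)"
proof -
  define c where "c = u + v"
  define N where "N = (\<lambda>u. sn k u * cn k (c - u) * dn k (c - u) + sn k (c - u) * cn k u * dn k u)"
  define D where "D = (\<lambda>u. 1 - k\<^sup>2 * (sn k u)\<^sup>2 * (sn k (c - u))\<^sup>2)"
  have "((\<lambda>u. N u / D u) has_real_derivative 0) (at t)" for t
  proof (rule quotient_deriv_zero)
    note rel = sn_cn_sq[of t] sn_cn_sq[of "c - t"] dn_sq[of t] dn_sq[of "c - t"]
    note derivs = sn_deriv cn_deriv dn_deriv
      DERIV_chain'[OF _ sn_deriv] DERIV_chain'[OF _ cn_deriv] DERIV_chain'[OF _ dn_deriv]
    \<comment> \<open>In the derivative of \<open>N\<close> the products of two cn and two dn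
      cancel, and the remaining squares are reduced to squares of sn.\<close>
    let ?N' = "2 * k\<^sup>2 * sn k t * sn k (c - t) * ((sn k t)\<^sup>2 - (sn k (c - t))\<^sup>2)"
    let ?D' = "- 2 * k\<^sup>2 * sn k t * sn k (c - t)
      * (cn k t * dn k t * sn k (c - t) - sn k t * cn k (c - t) * dn k (c - t))"
    show "(N has_real_derivative ?N') (at t)"
      unfolding N_def
      apply (rule derivative_eq_intros derivs refl)+
      using rel by algebra
    show "(D has_real_derivative ?D') (at t)"
      unfolding D_def
      apply (rule derivative_eq_intros derivs refl)+
      apply (simp add: algebra_simps power2_eq_square)
      done
    show "?N' * D t = N t * ?D'"
      unfolding N_def D_def by (rule sn_add_identity[OF rel])
    show "D t \<noteq> 0"
      using addition_denom_pos[of t "c - t"] by (simp add: D_def)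
  qed
  from isconst_if_deriv_zero[OF this, of u 0] show ?thesis by (simp add: N_def D_def c_def)
qed

lemma cn_add:
  "cn k (u + v) = (cn k u * cn k v - sn k u * sn k v * dn k u * dn k v)
     / (1 - k\<^sup>2 * (sn k u)\<^sup>2 * (sn k v)\<^sup>2)"
proof -
  define c where "c = u + v"
  define N where "N = (\<lambda>u. cn k u * cn k (c - u) - sn k u * sn k (c - u) * dn k u * dn k (c - u))"
  define D where "D = (\<lambda>u. 1 - k\<^sup>2 * (sn k u)\<^sup>2 * (sn k (c - u))\<^sup>2)"
  have "((\<lambda>u. N u / D u) has_real_derivative 0) (at t)" for t
  proof (rule quotient_deriv_zero)
    note rel = sn_cn_sq[of t] sn_cn_sq[of "c - t"] dn_sq[of t] dn_sq[of "c - t"]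
    note derivs = sn_deriv cn_deriv dn_deriv
      DERIV_chain'[OF _ sn_deriv] DERIV_chain'[OF _ cn_deriv] DERIV_chain'[OF _ dn_deriv]
    let ?N' = "2 * k\<^sup>2 * sn k t * sn k (c - t)
      * (sn k t * cn k t * dn k (c - t) - sn k (c - t) * cn k (c - t) * dn k t)"
    let ?D' = "- 2 * k\<^sup>2 * sn k t * sn k (c - t)
      * (cn k t * dn k t * sn k (c - t) - sn k t * cn k (c - t) * dn k (c - t))"
    show "(N has_real_derivative ?N') (at t)"
      unfolding N_def
      apply (rule derivative_eq_intros derivs refl)+
      using rel by algebra
    show "(D has_real_derivative ?D') (at t)"
      unfolding D_def
      apply (rule derivative_eq_intros derivs refl)+
      apply (simp add: algebra_simps power2_eq_square)
      done
    show "?N' * D t = N t * ?D'"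
      unfolding N_def D_def by (rule cn_add_identity[OF rel])
    show "D t \<noteq> 0"
      using addition_denom_pos[of t "c - t"] by (simp add: D_def)
  qed
  from isconst_if_deriv_zero[OF this, of u 0] show ?thesis by (simp add: N_def D_def c_def)
qed

lemma chord_add: "dn k w * sn k v * sn k (v + w) + cn k v * cn k (v + w) = cn k w"
proof -
  note rel = sn_cn_sq[of v] sn_cn_sq[of w] dn_sq[of v] dn_sq[of w]
  have D: "1 - k\<^sup>2 * (sn k v)\<^sup>2 * (sn k w)\<^sup>2 \<noteq> 0" using addition_denom_pos[of v w] by simp
  \<comment> \<open>The addition theorems with their common denominator cleared: a polynomial
    identity modulo \<open>rel\<close>.\<close>
  have "dn k w * sn k v * (sn k v * cn k w * dn k w + sn k w * cn k v * dn k v)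
      + cn k v * (cn k v * cn k w - sn k v * sn k w * dn k v * dn k w)
      = cn k w * (1 - k\<^sup>2 * (sn k v)\<^sup>2 * (sn k w)\<^sup>2)"
    using rel by algebra
  then show ?thesis
    using D unfolding sn_add cn_add by (simp add: divide_simps)
qed

lemma chord_diff: "dn k w * sn k v * sn k (v - w) + cn k v * cn k (v - w) = cn k w"
  using chord_add[of "- w" v] by simp

end

text \<open>\<open>X\<close> and \<open>Y\<close> will be the squares of sn at \<open>h\<close> and
  \<open>h / 2\<close>, in increasing order. Then \<open>(1 - Y) / (1 - X)\<close> and its product
  with \<open>r\<close> are the eigenvalues b and a for h < 4K/3 and their reciprocals for h > 4K/3.
  The last bound amounts to (1 - k^2)(Y - X) > 0.\<close>

lemma eigenvalue_ratio_less:
  fixes k X Y :: real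
  assumes "k\<^sup>2 < 1" "0 \<le> X" "X < Y" "Y < 1"
  defines "r \<equiv> (1 - k\<^sup>2 * X) / (1 - k\<^sup>2 * Y)"
  shows "0 < (1 - Y) / (1 - X)" "0 < r" "k \<noteq> 0 \<Longrightarrow> 1 < r" "(1 - Y) / (1 - X) * r < 1"
proof -
  show "0 < (1 - Y) / (1 - X)" using assms by simp
  have "k\<^sup>2 * Y \<le> 1 * Y" using assms by (intro mult_right_mono) auto
  then have Y: "1 - k\<^sup>2 * Y > 0" using \<open>Y < 1\<close> by linarith
  have "k\<^sup>2 * X \<le> k\<^sup>2 * Y" using assms by (intro mult_left_mono) auto
  then show "0 < r" unfolding r_def using Y by (intro divide_pos_pos) linarith+
  show "1 < r" if "k \<noteq> 0"
  proof -
    have "k\<^sup>2 * X < k\<^sup>2 * Y" using assms that by simp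
    then show ?thesis unfolding r_def using Y by simp
  qed
  have "(1 - k\<^sup>2) * X < (1 - k\<^sup>2) * Y" using assms by simp
  then have "(1 - Y) * (1 - k\<^sup>2 * X) < (1 - X) * (1 - k\<^sup>2 * Y)"
    by (simp add: algebra_simps)
  then show "(1 - Y) / (1 - X) * r < 1"
    unfolding r_def using Y assms by simp
qed

section \<open>Comparison of the values at \<open>h\<close> and \<open>h / 2\<close>, and the order
  of the eigenvalues\<close>

context
  fixes k :: real
  assumes k: "k\<^sup>2 < 1"
begin

lemma sn_less:
  assumes "0 \<le> u" "u < v" "v \<le> ellipticK k"
  shows "sn k u < sn k v"
proof -
  have "jacobi_am k 0 \<le> jacobi_am k u" "jacobi_am k u < jacobi_am k v"
    "jacobi_am k v \<le> jacobi_am k (ellipticK k)"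
    using assms by (simp_all add: jacobi_am_less_iff[OF k] flip: not_less)
  then show ?thesis
    unfolding sn_def using pi_gt_zero
    by (intro sin_monotone_2pi)
      (simp_all add: jacobi_am_0[OF k] jacobi_am_ellipticK[OF k])
qed

lemma sn_reflect: "sn k (2 * ellipticK k - u) = sn k u"
  and cn_reflect: "cn k (2 * ellipticK k - u) = - cn k u"
  by (simp_all add: sn_def cn_def jacobi_am_reflect[OF k])

lemma cn_ellipticK: "cn k (ellipticK k) = 0"
  by (simp add: cn_def jacobi_am_ellipticK[OF k])

lemma cn_pos:
  assumes "0 \<le> u" "u < ellipticK k"
  shows "cn k u > 0"
proof -
  have "jacobi_am k 0 \<le> jacobi_am k u" "jacobi_am k u < jacobi_am k (ellipticK k)"
    using assms by (simp_all add: jacobi_am_less_iff[OF k] flip: not_less)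
  then show ?thesis
    unfolding cn_def
    by (intro cos_gt_zero_pi) (simp_all add: jacobi_am_0[OF k] jacobi_am_ellipticK[OF k])
qed

lemma cn_nonzero:
  assumes "0 < u" "u < 2 * ellipticK k" "u \<noteq> ellipticK k"
  shows "cn k u \<noteq> 0"
  using assms cn_pos[of u] cn_pos[of "2 * ellipticK k - u"] cn_reflect[of u]
  by (cases "u < ellipticK k") auto

lemma sn_half_less:
  assumes "0 < h" "h < 4 / 3 * ellipticK k"
  shows "(sn k (h / 2))\<^sup>2 < (sn k h)\<^sup>2"
proof -
  have "0 < sn k (h / 2)"
    using sn_less[of 0 "h / 2"] assms by (simp add: sn_0[OF k])
  \<comment> \<open>Beyond K, \<open>h\<close> is replaced by its mirror image 2K - h, which has the
    same sn and exceeds h/2 exactly when h < 4K/3.\<close>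
  moreover have "sn k (h / 2) < sn k h"
    using sn_less[of "h / 2" h] sn_less[of "h / 2" "2 * ellipticK k - h"] assms sn_reflect[of h]
    by (cases "h \<le> ellipticK k") auto
  ultimately show ?thesis by (intro power_strict_mono) auto
qed

text \<open>Now the mirror image 2K - h lies below h/2, and both lie in [0, K], where sn
  increases.\<close>

lemma sn_half_greater:
  assumes "4 / 3 * ellipticK k < h" "h < 2 * ellipticK k"
  shows "(sn k h)\<^sup>2 < (sn k (h / 2))\<^sup>2"
proof -
  have "0 < sn k h"
    using sn_less[of 0 "2 * ellipticK k - h"] assms ellipticK_pos[OF k]
    by (simp add: sn_0[OF k] sn_reflect)
  moreover have "sn k h < sn k (h / 2)"
    using sn_less[of "2 * ellipticK k - h" "h / 2"] assms by (simp add: sn_reflect)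
  ultimately show ?thesis by (intro power_strict_mono) auto
qed

lemma eig_b_eq: "eig_b k h = (1 - (sn k h)\<^sup>2) / (1 - (sn k (h / 2))\<^sup>2)"
proof -
  have "(cn k u)\<^sup>2 = 1 - (sn k u)\<^sup>2" for u
    using sn_cn_sq[OF k, of u] by linarith
  then show ?thesis by (simp only: eig_b_def power_divide)
qed

lemma eig_a_eq:
  "eig_a k h = eig_b k h * ((1 - k\<^sup>2 * (sn k (h / 2))\<^sup>2) / (1 - k\<^sup>2 * (sn k h)\<^sup>2))"
  by (simp add: eig_a_def eig_b_def cd_def power_divide power_mult_distrib
      dn_sq[OF k, symmetric])

lemma sn_sq_less_one: "cn k u \<noteq> 0 \<Longrightarrow> (sn k u)\<^sup>2 < 1"
  using sn_cn_sq[OF k, of u] zero_less_power2[of "cn k u"] by linarith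

text \<open>At \<open>h = ellipticK k\<close> both eigenvalues vanish, so that value is excluded.
  Only the comparison of the two asks for \<open>k \<noteq> 0\<close>, since for
  \<open>k = 0\<close> they coincide.\<close>

lemma eig_order_below:
  assumes "0 < h" "h < 4 / 3 * ellipticK k" "h \<noteq> ellipticK k"
  shows "1 > eig_a k h" "k \<noteq> 0 \<Longrightarrow> eig_a k h > eig_b k h" "eig_b k h > 0"
proof -
  have "(sn k h)\<^sup>2 < 1"
    using assms ellipticK_pos[OF k] by (intro sn_sq_less_one cn_nonzero) auto
  note * = eigenvalue_ratio_less[OF k _ sn_half_less[OF assms(1,2)] this, folded eig_b_eq,
      folded eig_a_eq]
  show "1 > eig_a k h" "eig_b k h > 0"
    using * by simp_all
  show "eig_a k h > eig_b k h" if "k \<noteq> 0"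
    using mult_strict_left_mono[OF *(3) *(1)] that by (simp add: eig_a_eq)
qed

lemma eig_order_above:
  assumes "4 / 3 * ellipticK k < h" "h < 2 * ellipticK k"
  shows "k \<noteq> 0 \<Longrightarrow> eig_b k h > eig_a k h" "eig_a k h > 1"
proof -
  define X Y where "X = (sn k h)\<^sup>2" and "Y = (sn k (h / 2))\<^sup>2"
  \<comment> \<open>The smaller square now belongs to \<open>h\<close>, so \<open>b\<close> and
    \<open>b * r\<close> are the reciprocals of the eigenvalues.\<close>
  define b r where "b = (1 - Y) / (1 - X)" and "r = (1 - k\<^sup>2 * X) / (1 - k\<^sup>2 * Y)"
  have "Y < 1"
    unfolding Y_def using assms ellipticK_pos[OF k] by (intro sn_sq_less_one cn_nonzero) auto
  then have *: "0 < b" "0 < r" "k \<noteq> 0 \<Longrightarrow> 1 < r" "b * r < 1"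
    unfolding b_def r_def
    using eigenvalue_ratio_less[OF k _ sn_half_greater[OF assms]]
    by (simp_all add: X_def Y_def)
  have eig: "eig_b k h = inverse b" "eig_a k h = inverse (b * r)"
    unfolding eig_a_eq eig_b_eq by (simp_all add: b_def r_def X_def Y_def)
  show "eig_a k h > 1" unfolding eig using * by (intro one_less_inverse) auto
  show "eig_b k h > eig_a k h" if "k \<noteq> 0"
    unfolding eig using *(1,3) that by (intro less_imp_inverse_less) auto
qed

text \<open>At this \<open>h\<close> the mirror image 2K - h is h/2 itself, so sn agrees at
  \<open>h\<close> and \<open>h / 2\<close>.\<close>

lemma eig_third:
  "eig_a k (4 * ellipticK k * (1 / 3)) = 1" "eig_b k (4 * ellipticK k * (1 / 3)) = 1"
proof -
  let ?h = "4 * ellipticK k * (1 / 3)"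
  have "sn k ?h = sn k (2 * ellipticK k - ?h)" by (simp only: sn_reflect)
  also have "2 * ellipticK k - ?h = ?h / 2" by simp
  finally have sn: "sn k ?h = sn k (?h / 2)" .
  have 1: "(sn k (?h / 2))\<^sup>2 < 1"
    using ellipticK_pos[OF k] by (intro sn_sq_less_one cn_nonzero) auto
  show b: "eig_b k ?h = 1" using 1 unfolding eig_b_eq sn by simp
  have "1 - k\<^sup>2 * (sn k (?h / 2))\<^sup>2 \<noteq> 0"
    using dn_pos[OF k, of "?h / 2"] dn_sq[OF k, of "?h / 2"] by auto
  then show "eig_a k ?h = 1" unfolding eig_a_eq b sn by simp
qed

lemma eig_quarter:
  "eig_a k (4 * ellipticK k * (1 / 4)) = 0" "eig_b k (4 * ellipticK k * (1 / 4)) = 0"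
  by (simp_all add: eig_a_def eig_b_def cd_def cn_ellipticK)

end

lemma eig_modulus_0: "eig_a 0 h = eig_b 0 h"
  by (simp add: eig_a_eq)

section \<open>Projective geometry of points on a circle\<close>

lemma act_span: "act M (span X) = span ((*v) M ` X)"
  unfolding act_def by (simp add: linear_span_image)

lemma act_join: "act M (join A B) = join (act M A) (act M B)"
  unfolding join_def act_span by (simp add: act_def image_Un)

lemma inj_act_iff:
  fixes M :: "real^3^3"
  assumes "invertible M"
  shows "act M A = act M B \<longleftrightarrow> A = B"
  unfolding act_def using assms by (intro inj_image_eq_iff inj_matrix_vector_mult)

text \<open>Linear maps commute with spans, and injective ones also with intersections. This carries
  the second pentagram step through the scaling.\<close>

lemma pentagram_act:
  assumes "invertible M"
  shows "pentagram (act_polygon M P) = act_polygon M (pentagram P)"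
  using inj_matrix_vector_mult[OF assms]
  by (auto simp: fun_eq_iff pentagram_def act_polygon_def act_join[symmetric])
    (auto simp: act_def image_Int)

lemma pentagram_defined_act:
  assumes "invertible M"
  shows "pentagram_defined (act_polygon M P) \<longleftrightarrow> pentagram_defined P"
  by (simp add: pentagram_defined_def act_polygon_def act_join[symmetric] inj_act_iff[OF assms])

lemma join_span: "join (span A) (span B) = span (A \<union> B)"
proof
  have "span A \<subseteq> span (A \<union> B)" "span B \<subseteq> span (A \<union> B)"
    by (auto intro!: span_mono)
  then show "join (span A) (span B) \<subseteq> span (A \<union> B)"
    unfolding join_def by (intro span_minimal) auto
  show "span (A \<union> B) \<subseteq> join (span A) (span B)"
    unfolding join_def by (intro span_mono Un_mono span_superset)
qed

section \<open>Projective lines given by normal vectors, and their intersections\<close>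

lemma span_pair_eq_plane:
  fixes p q l :: "real^3"
  assumes "l \<noteq> 0" "l \<bullet> p = 0" "l \<bullet> q = 0" "independent {p, q}" "p \<noteq> q"
  shows "span {p, q} = {x. l \<bullet> x = 0}"
proof (rule subspace_dim_equal)
  show "span {p, q} \<subseteq> {x. l \<bullet> x = 0}"
    using assms by (intro span_minimal subspace_hyperplane) auto
  have "dim {x. l \<bullet> x = 0} = 2"
    using dim_hyperplane[OF assms(1)] by simp
  then show "dim {x. l \<bullet> x = 0} \<le> dim (span {p, q})"
    using dim_eq_card_independent[OF assms(4)] assms(5) by simp
qed (auto simp: subspace_hyperplane)

lemma planes_inter:
  fixes l m z :: "real^3"
  assumes "l \<noteq> 0" "\<And>c. m \<noteq> c *\<^sub>R l" "z \<noteq> 0" "l \<bullet> z = 0" "m \<bullet> z = 0"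
  shows "{x. l \<bullet> x = 0} \<inter> {x. m \<bullet> x = 0} = span {z}"
proof
  have "m \<noteq> 0" using assms(2)[of 0] by simp
  then have lm: "cross3 l m \<noteq> 0"
    using assms by (auto simp: cross_eq_0 collinear_lemma)
  \<comment> \<open>By the triple product expansion, a vector orthogonal to \<open>l\<close> and
    \<open>m\<close> is parallel to their cross product.\<close>
  have par: "\<exists>c. x = c *\<^sub>R cross3 l m" if "l \<bullet> x = 0" "m \<bullet> x = 0" for x
  proof -
    have "cross3 (cross3 l m) x = 0"
      using that Lagrange[of x l m] cross_skew[of "cross3 l m" x] by (simp add: inner_commute)
    then show ?thesis
      using lm by (auto simp: cross_eq_0 collinear_lemma intro: exI[of _ 0])
  qed
  show "{x. l \<bullet> x = 0} \<inter> {x. m \<bullet> x = 0} \<subseteq> span {z}"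
  proof clarify
    fix x assume x: "l \<bullet> x = 0" "m \<bullet> x = 0"
    obtain c d where c: "z = c *\<^sub>R cross3 l m" and d: "x = d *\<^sub>R cross3 l m"
      using par assms(4,5) x by meson
    have "c \<noteq> 0" using c assms(3) by auto
    then have "x = (d / c) *\<^sub>R z" using c d by simp
    then show "x \<in> span {z}" by (simp add: span_scale span_base)
  qed
  show "span {z} \<subseteq> {x. l \<bullet> x = 0} \<inter> {x. m \<bullet> x = 0}"
    using assms by (auto simp: span_singleton)
qed

text \<open>Fixing the third coordinate at 1 turns equality of projective points into equality of
  vectors.\<close>

definition on_circle :: "real^3 \<Rightarrow> bool" where
  "on_circle x \<longleftrightarrow> (x $ 1)\<^sup>2 + (x $ 2)\<^sup>2 = 1 \<and> x $ 3 = 1"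

text \<open>A line meets a circle in at most two points, since the position along the line is
  determined up to sign.\<close>

lemma circle_not_collinear:
  assumes "on_circle x" "on_circle y" "on_circle z" "x \<noteq> y" "x \<noteq> z" "y \<noteq> z"
    and "l \<bullet> x = 0" "l \<bullet> y = 0" "l \<bullet> z = 0"
  shows "l = 0"
proof (rule ccontr)
  assume "l \<noteq> 0"
  \<comment> \<open>\<open>D\<close> is the squared length of the affine normal of the line, and
    \<open>t\<close> is the coordinate along the line, scaled by sqrt D.\<close>
  define D where "D = (l$1)\<^sup>2 + (l$2)\<^sup>2"
  define t where "t = (\<lambda>p::real^3. l$1 * p$2 - l$2 * p$1)"
  have line: "l$1 * p$1 + l$2 * p$2 = - l$3" if "on_circle p" "l \<bullet> p = 0" for p
    using that by (simp add: on_circle_def inner_vec_def sum_3)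
  \<comment> \<open>Otherwise \<open>l\<close> would be the line at infinity, which misses the
    circle.\<close>
  have D: "D \<noteq> 0"
  proof
    assume "D = 0"
    then have "l$1 = 0" "l$2 = 0" by (simp_all add: D_def sum_power2_eq_zero_iff)
    moreover from this have "l$3 = 0" using line assms by fastforce
    ultimately show False using \<open>l \<noteq> 0\<close> by (simp add: vec_eq_iff forall_3)
  qed
  have t_sq: "(t p)\<^sup>2 = D - (l$3)\<^sup>2" if "on_circle p" "l \<bullet> p = 0" for p
    using line[OF that] that(1) unfolding t_def D_def on_circle_def by algebra
  have eqI: "p = q" if p: "on_circle p" "l \<bullet> p = 0" and q: "on_circle q" "l \<bullet> q = 0"
    and "t p = t q" for p q
  proof -
    have "D * p$1 = D * q$1" "D * p$2 = D * q$2"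
      using line[OF p] line[OF q] \<open>t p = t q\<close> unfolding t_def D_def by algebra+
    then show ?thesis using D p q by (simp add: vec_eq_iff forall_3 on_circle_def)
  qed
  have "(t x)\<^sup>2 = (t y)\<^sup>2" "(t x)\<^sup>2 = (t z)\<^sup>2"
    using t_sq assms by simp_all
  then have "t x = t y \<or> t x = t z \<or> t y = t z"
    by (auto simp: power2_eq_iff)
  then show False using eqI assms by blast
qed

lemma circle_cross_nonzero:
  assumes "on_circle y" "on_circle z" "y \<noteq> z"
  shows "cross3 y z \<noteq> 0"
  using assms by (auto simp: on_circle_def cross3_def vec_eq_iff forall_3)

lemma circle_triple_nonzero:
  assumes "on_circle x" "on_circle y" "on_circle z" "x \<noteq> y" "x \<noteq> z" "y \<noteq> z"
  shows "cross3 y z \<bullet> x \<noteq> 0"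
  using circle_not_collinear[OF assms, of "cross3 y z"] circle_cross_nonzero[of y z] assms
  by (auto simp: dot_cross_self)

lemma circle_span_UNIV:
  assumes "on_circle x" "on_circle y" "on_circle z" "x \<noteq> y" "x \<noteq> z" "y \<noteq> z"
  shows "span {x, y, z} = UNIV"
proof (rule ccontr)
  assume "span {x, y, z} \<noteq> UNIV"
  then obtain l where "l \<noteq> 0" and sub: "span {x, y, z} \<subseteq> {v. l \<bullet> v = 0}"
    using span_not_univ_subset_hyperplane by blast
  moreover have "x \<in> span {x, y, z}" "y \<in> span {x, y, z}" "z \<in> span {x, y, z}"
    by (auto intro: span_base)
  ultimately show False using circle_not_collinear[OF assms, of l] by auto
qed

lemma circle_independent:
  assumes "on_circle p" "on_circle q" "p \<noteq> q"
  shows "independent {p, q}"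
proof -
  have "p \<noteq> c *\<^sub>R q" for c
    using assms by (auto simp: on_circle_def vec_eq_iff forall_3)
  moreover have "q \<noteq> 0" using assms(2) by (auto simp: on_circle_def)
  ultimately show ?thesis
    using assms(3) by (auto simp: independent_insert span_singleton)
qed

text \<open>The line \<open>l\<close> already meets the circle in \<open>p\<close> and
  \<open>q\<close>, so \<open>r\<close> is off it. Hence the diagonals differ, and any nonzero
  common vector \<open>z\<close> spans their intersection.\<close>

lemma circle_diagonals:
  assumes circle: "on_circle p" "on_circle q" "on_circle r" "on_circle s"
    and dist: "p \<noteq> q" "p \<noteq> r" "q \<noteq> r" "r \<noteq> s"
    and l: "l \<noteq> 0" "l \<bullet> p = 0" "l \<bullet> q = 0" and m: "m \<noteq> 0" "m \<bullet> r = 0" "m \<bullet> s = 0"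
    and z: "z \<noteq> 0" "l \<bullet> z = 0" "m \<bullet> z = 0"
  shows "span {p, q} \<inter> span {r, s} = span {z}" and "span {p, q} \<noteq> span {r, s}"
proof -
  have pq: "span {p, q} = {x. l \<bullet> x = 0}" and rs: "span {r, s} = {x. m \<bullet> x = 0}"
    using assms by (intro span_pair_eq_plane circle_independent; simp)+
  have r: "l \<bullet> r \<noteq> 0"
    using circle_not_collinear[of p q r l] assms by blast
  have "m \<noteq> c *\<^sub>R l" for c
    using m r by auto
  then show "span {p, q} \<inter> span {r, s} = span {z}"
    unfolding pq rs using l z by (intro planes_inter) auto
  show "span {p, q} \<noteq> span {r, s}"
    unfolding pq rs using r m by auto
qed

text \<open>No three of four circle points are collinear, so they form a projective frame: the
  scalars at three of them are forced to agree with the one at the fourth.\<close>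

lemma projectivity_unique:
  fixes A M :: "real^3^3"
  assumes inv: "invertible A"
    and circle: "on_circle x" "on_circle y" "on_circle z" "on_circle w"
    and dist: "x \<noteq> y" "x \<noteq> z" "x \<noteq> w" "y \<noteq> z" "y \<noteq> w" "z \<noteq> w"
    and M: "M *v x = c1 *\<^sub>R (A *v x)" "M *v y = c2 *\<^sub>R (A *v y)" "M *v z = c3 *\<^sub>R (A *v z)"
      "M *v w = c *\<^sub>R (A *v w)"
  shows "M = c *\<^sub>R A"
proof -
  have "w \<in> span {x, y, z}"
    using circle_span_UNIV[of x y z] circle dist by simp
  then obtain r s t where "w = r *\<^sub>R x + s *\<^sub>R y + t *\<^sub>R z"
    by (auto simp: span_insert span_singleton algebra_simps)
  then have w: "r *\<^sub>R x + s *\<^sub>R y + t *\<^sub>R z = w" ..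
  \<comment> \<open>\<open>M *v w\<close> is computed directly and through the expansion of
    \<open>w\<close>; injectivity of \<open>A\<close> then compares the two.\<close>
  have "A *v (c *\<^sub>R w) = A *v ((r * c1) *\<^sub>R x + (s * c2) *\<^sub>R y + (t * c3) *\<^sub>R z)"
    using M unfolding w[symmetric]
    by (simp add: matrix_vector_right_distrib matrix_vector_mult_scaleR ac_simps)
  then have "c *\<^sub>R w = (r * c1) *\<^sub>R x + (s * c2) *\<^sub>R y + (t * c3) *\<^sub>R z"
    using inj_matrix_vector_mult[OF inv] by (auto dest: injD)
  then have rel: "(r * (c1 - c)) *\<^sub>R x + (s * (c2 - c)) *\<^sub>R y + (t * (c3 - c)) *\<^sub>R z = 0"
    unfolding w[symmetric] by (simp add: algebra_simps)
  \<comment> \<open>Pairing with \<open>cross3 y z\<close> isolates the coefficient of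
    \<open>x\<close>. As \<open>w\<close> is off the line through \<open>y\<close> and
    \<open>z\<close>, \<open>r\<close> is nonzero and can be cancelled. The points stay general so
    that each coordinate can take the place of \<open>x\<close>.\<close>
  have coeff: "e = c"
    if "on_circle x" "on_circle y" "on_circle z" "on_circle w"
      and "x \<noteq> y" "x \<noteq> z" "y \<noteq> z" "w \<noteq> y" "w \<noteq> z"
      and w: "r *\<^sub>R x + s *\<^sub>R y + t *\<^sub>R z = w"
      and rel: "(r * (e - c)) *\<^sub>R x + s' *\<^sub>R y + t' *\<^sub>R z = 0"
    for x y z w r s t s' t' e
  proof -
    let ?l = "cross3 y z"
    have l: "?l \<bullet> y = 0" "?l \<bullet> z = 0" "?l \<bullet> x \<noteq> 0" "?l \<bullet> w \<noteq> 0"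
      using circle_triple_nonzero that by (auto simp: dot_cross_self)
    have "r * (?l \<bullet> x) = ?l \<bullet> w"
      using l by (simp add: w[symmetric] inner_simps)
    moreover have "r * (e - c) * (?l \<bullet> x) = ?l \<bullet> 0"
      unfolding rel[symmetric] using l by (simp add: inner_simps)
    ultimately show ?thesis using l by auto
  qed
  have "c1 = c"
    by (rule coeff[OF _ _ _ _ _ _ _ _ _ w rel]) (use circle dist in auto)
  moreover have "c2 = c"
    by (rule coeff[of y x z w s r t _ "r * (c1 - c)" "t * (c3 - c)"])
      (use circle dist w rel in \<open>auto simp: ac_simps\<close>)
  moreover have "c3 = c"
    by (rule coeff[of z x y w t r s _ "r * (c1 - c)" "s * (c2 - c)"])
      (use circle dist w rel in \<open>auto simp: ac_simps\<close>)
  ultimately have "M *v v = (c *\<^sub>R A) *v v" if "v \<in> {x, y, z}" for v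
    using that M by (auto simp: scaleR_matrix_vector_assoc)
  then have "M *v v = (c *\<^sub>R A) *v v" for v
    using linear_eq_on_span[of "(*v) M" "(*v) (c *\<^sub>R A)" "{x, y, z}" v]
      circle_span_UNIV[of x y z] circle dist by auto
  then show ?thesis by (simp add: matrix_eq)
qed

section \<open>Diagonal matrices and their spectra\<close>

lemma Spec_diag3: "Spec (diag3 x y z) = {of_real x, of_real y, of_real z}"
proof -
  have "map_matrix complex_of_real (diag3 x y z) *v v = c *s v \<longleftrightarrow>
      (of_real x = c \<or> v$1 = 0) \<and> (of_real y = c \<or> v$2 = 0) \<and> (of_real z = c \<or> v$3 = 0)" for v c
    by (auto simp: vec_eq_iff forall_3 matrix_vector_mult_def sum_3 diag3_def)
  then have iff: "c \<in> Spec (diag3 x y z) \<longleftrightarrow> (\<exists>v::complex^3. v \<noteq> 0 \<and>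
      (of_real x = c \<or> v$1 = 0) \<and> (of_real y = c \<or> v$2 = 0) \<and> (of_real z = c \<or> v$3 = 0))" for c
    by (simp add: Spec_def)
  show ?thesis
  proof (intro set_eqI)
    fix c
    have "vector [1, 0, 0] \<noteq> (0 :: complex^3)" "vector [0, 1, 0] \<noteq> (0 :: complex^3)"
      "vector [0, 0, 1] \<noteq> (0 :: complex^3)"
      by (auto simp: vec_eq_iff forall_3)
    moreover have "v = 0" if "v$1 = 0" "v$2 = 0" "v$3 = 0" for v :: "complex^3"
      using that by (simp add: vec_eq_iff forall_3)
    ultimately show "c \<in> Spec (diag3 x y z) \<longleftrightarrow> c \<in> {of_real x, of_real y, of_real z}"
      unfolding iff
      by (auto intro: exI[of _ "vector [1, 0, 0]"] exI[of _ "vector [0, 1, 0]"]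
          exI[of _ "vector [0, 0, 1]"])
  qed
qed

lemma charpoly_diag3:
  "charpoly (map_matrix complex_of_real (diag3 x y z))
    = [:- of_real x, 1:] * [:- of_real y, 1:] * [:- of_real z, 1:]"
  by (simp add: charpoly_def det_3 diag3_def)

lemma order_simple_root:
  fixes q :: "'a::idom poly"
  assumes "poly q c \<noteq> 0"
  shows "order c ([:- c, 1:] * q) = 1"
proof -
  have "q \<noteq> 0" using assms by auto
  then have "[:- c, 1:] * q \<noteq> 0" by (simp only: mult_eq_0_iff) simp
  then have "order c ([:- c, 1:] * q) = order c [:- c, 1:] + order c q"
    by (rule order_mult)
  then show ?thesis
    using order_0I[OF assms] order_power_n_n[of c 1] by simp
qed

lemma simple_spectrum_diag3:
  assumes "x \<noteq> y" "x \<noteq> z" "y \<noteq> z"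
  shows "simple_spectrum (diag3 x y z)"
proof -
  \<comment> \<open>For each diagonal entry its own factor comes first; the other two factors do not
    vanish there.\<close>
  have "order (complex_of_real x) ([:- of_real x, 1:] * ([:- of_real y, 1:] * [:- of_real z, 1:])) = 1"
    "order (complex_of_real y) ([:- of_real y, 1:] * ([:- of_real x, 1:] * [:- of_real z, 1:])) = 1"
    "order (complex_of_real z) ([:- of_real z, 1:] * ([:- of_real x, 1:] * [:- of_real y, 1:])) = 1"
    using assms by (intro order_simple_root; simp only: poly_mult; simp)+
  then show ?thesis
    unfolding simple_spectrum_def Spec_diag3 charpoly_diag3
    by (simp only: ball_simps mult.assoc mult.left_commute mult.commute)
qed

section \<open>The pentagram map on Poncelet polygons\<close>

definition circle_vec :: "real \<Rightarrow> real \<Rightarrow> real^3" where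
  "circle_vec k u = vector [sn k u, cn k u, 1]"

text \<open>The normal vector of the chord with endpoint parameters \<open>v - w\<close> and
  \<open>v + w\<close>.\<close>

definition chord_vec :: "real \<Rightarrow> real \<Rightarrow> real \<Rightarrow> real^3" where
  "chord_vec k v w = vector [dn k w * sn k v, cn k v, - cn k w]"

lemma circle_point_eq_span: "circle_point k u = span {circle_vec k u}"
  by (simp add: circle_point_def proj_point_def circle_vec_def)

lemma on_circle_vec: "on_circle (circle_vec k u)"
  by (simp add: on_circle_def circle_vec_def sn_def cn_def)

lemma circle_vec_nonzero: "circle_vec k u \<noteq> 0"
  by (auto simp: circle_vec_def vec_eq_iff forall_3)

lemma circle_point_RP2: "circle_point k u \<in> RP2"
  using circle_vec_nonzero[of k u] by (simp add: RP2_def circle_point_eq_span)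

lemma diag3_mult_vec: "diag3 x y z *v v = vector [x * v$1, y * v$2, z * v$3]"
  by (simp add: vec_eq_iff forall_3 matrix_vector_mult_def sum_3 diag3_def)

lemma diag3_mult: "diag3 x y z ** diag3 x' y' z' = diag3 (x * x') (y * y') (z * z')"
  by (simp add: vec_eq_iff forall_3 matrix_matrix_mult_def sum_3 diag3_def)

lemma diag3_invertible:
  assumes "x \<noteq> 0" "y \<noteq> 0" "z \<noteq> 0"
  shows "invertible (diag3 x y z)"
  using assms by (simp add: invertible_det_nz det_3 diag3_def)

context
  fixes k :: real
  assumes k: "k\<^sup>2 < 1"
begin

text \<open>Equal sine and cosine mean amplitudes differing by a multiple of 2 pi, which is the gain
  of the amplitude over \<open>4 * ellipticK k\<close>.\<close>

lemma circle_vec_eq_iff: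
  "circle_vec k u = circle_vec k v \<longleftrightarrow> (\<exists>m::int. u = v + of_int m * (4 * ellipticK k))"
proof -
  have "circle_vec k u = circle_vec k v
      \<longleftrightarrow> (\<exists>m::int. jacobi_am k u = jacobi_am k v + 2 * pi * m)"
    by (simp add: circle_vec_def vec_eq_iff forall_3 sn_def cn_def sin_cos_eq_iff)
  also have "\<dots> \<longleftrightarrow> (\<exists>m::int. jacobi_am k u = jacobi_am k (v + of_int m * (4 * ellipticK k)))"
    unfolding jacobi_am_period_int[OF k] by (simp add: ac_simps)
  finally show ?thesis by (simp add: jacobi_am_eq_iff[OF k])
qed

lemma chord_vec_inner:
  "chord_vec k v w \<bullet> circle_vec k (v + w) = 0" "chord_vec k v w \<bullet> circle_vec k (v - w) = 0"
  using chord_add[OF k, of w v] chord_diff[OF k, of w v]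
  by (simp_all add: chord_vec_def circle_vec_def inner_vec_def sum_3)

lemma chord_vec_nonzero: "chord_vec k v w \<noteq> 0"
proof
  assume "chord_vec k v w = 0"
  then have "sn k v = 0" "cn k v = 0"
    using dn_pos[OF k, of w] by (auto simp: chord_vec_def vec_eq_iff forall_3)
  then show False using sn_cn_sq[OF k, of v] by simp
qed

text \<open>The scaling factors are such that dn h * s_x and s_y are cn h / cn (h/2) times dn (h/2)
  and 1, so the pairing reduces to the chord identity of half-width h/2.\<close>

lemma chord_vec_scaling:
  assumes "cn k (h / 2) \<noteq> 0" and "v = m + h / 2 \<or> v = m - h / 2"
  shows "chord_vec k v h \<bullet> (scaling k h *v circle_vec k m) = 0"
proof -
  have "dn k (h/2) * sn k v * sn k m + cn k v * cn k m = cn k (h/2)"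
    using assms(2) chord_add[OF k, of "h/2" v] chord_diff[OF k, of "h/2" v] by auto
  then have "cn k h / cn k (h/2) * (dn k (h/2) * sn k v * sn k m + cn k v * cn k m) = cn k h"
    using assms(1) by simp
  then show ?thesis
    using assms(1) dn_pos[OF k, of h]
    by (simp add: chord_vec_def circle_vec_def scaling_def diag3_mult_vec inner_vec_def sum_3
        s_x_def s_y_def field_simps)
qed

lemma scaling_invertible:
  assumes "cn k h \<noteq> 0" "cn k (h / 2) \<noteq> 0"
  shows "invertible (scaling k h)"
  using assms dn_pos[OF k, of h] dn_pos[OF k, of "h / 2"]
  by (auto simp: scaling_def s_x_def s_y_def intro!: diag3_invertible)

context
  fixes h :: real
  assumes sep: "\<forall>j \<in> {1..3}. \<forall>m :: int. of_int j * h \<noteq> of_int m * (4 * ellipticK k)"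
begin

text \<open>By \<open>sep\<close>, one, two or three steps never complete a whole number of periods,
  which separates any four consecutive vertices.\<close>

lemma circle_vec_distinct:
  assumes "i < j" "j \<le> i + 3"
  shows "circle_vec k (u + of_int i * h) \<noteq> circle_vec k (u + of_int j * h)"
proof
  assume "circle_vec k (u + of_int i * h) = circle_vec k (u + of_int j * h)"
  then obtain m :: int where "u + of_int i * h = u + of_int j * h + of_int m * (4 * ellipticK k)"
    by (auto simp: circle_vec_eq_iff)
  then have "of_int (j - i) * h = of_int (- m) * (4 * ellipticK k)"
    by (simp add: algebra_simps)
  moreover have "j - i \<in> {1..3}" using assms by simp
  ultimately show False using sep by blast
qed

lemma pentagram_poncelet:
  assumes c: "cn k h \<noteq> 0" "cn k (h / 2) \<noteq> 0"
  shows "pentagram (poncelet_polygon k h u) i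
      = act (scaling k h) (circle_point k (u + (of_int i + 3 / 2) * h))" (is ?inter)
    and "pentagram_defined (poncelet_polygon k h u)" (is ?defined)
proof -
  define p where "p = (\<lambda>i::int. circle_vec k (u + of_int i * h))"
  have P: "poncelet_polygon k h u i = span {p i}" for i
    by (simp add: p_def poncelet_polygon_def circle_point_eq_span)
  have dist: "p i \<noteq> p j" if "i < j" "j \<le> i + 3" for i j
    using circle_vec_distinct[OF that] by (simp add: p_def)
  have main: "span {p i, p (i + 2)} \<inter> span {p (i + 1), p (i + 3)}
        = span {scaling k h *v circle_vec k (u + (of_int i + 3 / 2) * h)}
      \<and> span {p i, p (i + 2)} \<noteq> span {p (i + 1), p (i + 3)}" for i
  proof -
    \<comment> \<open>The two diagonals are chords of half-width \<open>h\<close> centred at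
      \<open>?v\<close> and \<open>?w\<close>; \<open>?m\<close> lies midway, at
      \<open>h / 2\<close> from each.\<close>
    let ?v = "u + (of_int i + 1) * h" and ?w = "u + (of_int i + 2) * h"
      and ?m = "u + (of_int i + 3 / 2) * h"
    have eqs: "p i = circle_vec k (?v - h)" "p (i + 2) = circle_vec k (?v + h)"
      "p (i + 1) = circle_vec k (?w - h)" "p (i + 3) = circle_vec k (?w + h)"
      unfolding p_def by (rule arg_cong[of _ _ "circle_vec k"]; simp add: algebra_simps)+
    have "chord_vec k ?v h \<bullet> (scaling k h *v circle_vec k ?m) = 0"
      "chord_vec k ?w h \<bullet> (scaling k h *v circle_vec k ?m) = 0"
      by (rule chord_vec_scaling[OF c(2)]; simp add: field_simps)+
    moreover have "scaling k h *v circle_vec k ?m \<noteq> 0"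
      using circle_vec_nonzero injD[OF inj_matrix_vector_mult[OF scaling_invertible[OF c]], of _ 0]
      by auto
    moreover have "chord_vec k ?v h \<bullet> p i = 0" "chord_vec k ?v h \<bullet> p (i + 2) = 0"
      "chord_vec k ?w h \<bullet> p (i + 1) = 0" "chord_vec k ?w h \<bullet> p (i + 3) = 0"
      unfolding eqs by (simp_all add: chord_vec_inner)
    moreover have "on_circle (p j)" for j
      by (simp add: p_def on_circle_vec)
    ultimately show ?thesis
      using circle_diagonals[of "p i" "p (i + 2)" "p (i + 1)" "p (i + 3)"
          "chord_vec k ?v h" "chord_vec k ?w h"] dist[of i "i + 2"] dist[of i "i + 1"]
        dist[of "i + 1" "i + 2"] dist[of "i + 1" "i + 3"] chord_vec_nonzero
      by simp
  qed
  show ?inter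
    using main[of i] by (simp add: pentagram_def P join_span circle_point_eq_span act_span insert_commute)
  have "span {p i} \<noteq> span {p (i + 2)}" for i
    using circle_independent[of "p i" "p (i + 2)"] dist[of i "i + 2"]
    by (auto simp: p_def on_circle_vec independent_insert span_base)
  then show ?defined
    using main by (simp add: pentagram_defined_def P join_span insert_commute)
qed

text \<open>Up to the scaling, the image belongs to the same family with a shifted starting
  parameter, so the formula can be iterated.\<close>

lemma pentagram_poncelet_polygon:
  assumes "cn k h \<noteq> 0" "cn k (h / 2) \<noteq> 0"
  shows "pentagram (poncelet_polygon k h u)
    = act_polygon (scaling k h) (poncelet_polygon k h (u + 3 / 2 * h))"
  using pentagram_poncelet(1)[OF assms]
  by (simp add: fun_eq_iff act_polygon_def poncelet_polygon_def algebra_simps)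

lemma act_act: "act A (act B V) = act (A ** B) V"
  by (simp add: act_def image_image matrix_vector_mul_assoc)

text \<open>Two parameter shifts by \<open>3 / 2 * h\<close> add up to a shift of the labels by
  3.\<close>

lemma pentagram_poncelet_twice:
  assumes c: "cn k h \<noteq> 0" "cn k (h / 2) \<noteq> 0"
  shows "pentagram (pentagram (poncelet_polygon k h u)) i
    = act (scaling k h ** scaling k h) (poncelet_polygon k h u (i + 3))"
  unfolding pentagram_poncelet_polygon[OF c] pentagram_act[OF scaling_invertible[OF c]]
  by (simp add: act_polygon_def act_act poncelet_polygon_def algebra_simps)

text \<open>A lift must agree with the squared scaling, up to a scalar, at every vertex; four
  consecutive vertices already form a frame.\<close>

lemma forward_DS_lift_unique:
  assumes c: "cn k h \<noteq> 0" "cn k (h / 2) \<noteq> 0"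
  shows "forward_DS_lift (poncelet_polygon k h u) M
    \<longleftrightarrow> (\<exists>c. c \<noteq> 0 \<and> M = c *\<^sub>R (scaling k h ** scaling k h))"
proof -
  define G where "G = scaling k h ** scaling k h"
  define p where "p = (\<lambda>i::int. circle_vec k (u + of_int i * h))"
  have P: "poncelet_polygon k h u i = span {p i}" for i
    by (simp add: p_def poncelet_polygon_def circle_point_eq_span)
  have G: "invertible G"
    unfolding G_def by (intro invertible_mult scaling_invertible c)
  have lift: "forward_DS_lift (poncelet_polygon k h u) M
      \<longleftrightarrow> invertible M \<and> (\<forall>i. span {G *v p i} = span {M *v p i})"
  proof -
    \<comment> \<open>Shifting labels by 3 is a bijection of the integers.\<close>
    have "(\<forall>i. act G (span {p (i + 3)}) = act M (span {p (i + 3)}))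
        \<longleftrightarrow> (\<forall>i. act G (span {p i}) = act M (span {p i}))"
      by (metis diff_add_cancel)
    then show ?thesis
      by (simp add: forward_DS_lift_def fun_eq_iff pentagram_poncelet_twice[OF c] relabel_def
          act_polygon_def P flip: G_def) (simp add: act_span)
  qed
  show ?thesis
    unfolding G_def[symmetric] lift
  proof
    assume M: "invertible M \<and> (\<forall>i. span {G *v p i} = span {M *v p i})"
    have "\<exists>c. M *v p i = c *\<^sub>R (G *v p i)" for i
    proof -
      have "M *v p i \<in> span {G *v p i}" using M by (simp add: span_base)
      then show ?thesis by (auto simp: span_singleton)
    qed
    then obtain c where c: "M *v p i = c i *\<^sub>R (G *v p i)" for i by metis
    have dist: "p i \<noteq> p j" if "i < j" "j \<le> i + 3" for i j
      using circle_vec_distinct[OF that] by (simp add: p_def)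
    have circle: "on_circle (p i)" for i
      by (simp add: p_def on_circle_vec)
    have "M = c 3 *\<^sub>R G"
      by (rule projectivity_unique[OF G, of "p 0" "p 1" "p 2" "p 3" _ "c 0" "c 1" "c 2"])
        (rule circle c dist; simp)+
    \<comment> \<open>A zero scalar would make \<open>M\<close> the zero matrix.\<close>
    moreover from this have "c 3 \<noteq> 0"
      using M by (auto simp: invertible_det_nz det_3)
    ultimately show "\<exists>c. c \<noteq> 0 \<and> M = c *\<^sub>R G" by blast
  next
    assume "\<exists>c. c \<noteq> 0 \<and> M = c *\<^sub>R G"
    then obtain c where c: "c \<noteq> 0" "M = c *\<^sub>R G" by blast
    have "invertible M"
      using G c by (simp add: scalar_invertible)
    moreover have "span {G *v p i} = span {M *v p i}" for i
      using c span_image_scale[of "{G *v p i}" "\<lambda>_. c"] by (simp add: scaleR_matrix_vector_assoc[symmetric])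
    ultimately show "invertible M \<and> (\<forall>i. span {G *v p i} = span {M *v p i})" by blast
  qed
qed

end
end

section \<open>Specialization to the rational rotation number \<open>\<omega>\<close>\<close>

theorem proposition5p13:
  fixes n q :: int and \<epsilon> u0 \<omega> h a b :: real
    and P :: "int \<Rightarrow> (real ^ 3) set" and S G :: "real ^ 3 ^ 3"
  assumes "5 \<le> n" and "0 < q" and "real_of_int q < real_of_int n / 2" and "gcd q n = 1"
    and "0 \<le> \<epsilon>" and "\<epsilon> < 1"
    and "\<omega> = real_of_int q / real_of_int n"
    and "h = 4 * ellipticK \<epsilon> * \<omega>"
    and "P = poncelet_polygon \<epsilon> h u0"
    and "S = scaling \<epsilon> h"
    and "G = S ** S"
    and "a = eig_a \<epsilon> h" and "b = eig_b \<epsilon> h"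
  shows "labeled_ngon n P \<and>
    s_x \<epsilon> h = cd \<epsilon> h / cd \<epsilon> (h / 2) \<and>
    pentagram_defined P \<and>
    (\<forall>i. pentagram P i = act S (circle_point \<epsilon> (u0 + (real_of_int i + 3 / 2) * h))) \<and>
    pentagram_defined (pentagram P) \<and>
    (\<forall>i. pentagram (pentagram P) i = act (S ** S) (P (i + 3))) \<and>
    (\<forall>M. forward_DS_lift P M \<longleftrightarrow> (\<exists>c. c \<noteq> 0 \<and> M = c *\<^sub>R G)) \<and>
    G = diag3 a b 1 \<and>
    Spec G = {1, complex_of_real a, complex_of_real b} \<and>
    (0 < \<epsilon> \<longrightarrow>
           (0 < \<omega> \<and> \<omega> < 1 / 3 \<longrightarrow> 1 > a \<and> a > b \<and> b > 0) \<and>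
           eig_a \<epsilon> (4 * ellipticK \<epsilon> * (1 / 3)) = 1 \<and>
           eig_b \<epsilon> (4 * ellipticK \<epsilon> * (1 / 3)) = 1 \<and>
           (1 / 3 < \<omega> \<and> \<omega> < 1 / 2 \<longrightarrow> b > a \<and> a > 1)) \<and>
    eig_a \<epsilon> (4 * ellipticK \<epsilon> * (1 / 4)) = 0 \<and> eig_b \<epsilon> (4 * ellipticK \<epsilon> * (1 / 4)) = 0 \<and>
    \<omega> \<noteq> 1 / 3 \<and> \<omega> \<noteq> 1 / 4 \<and>
    (0 < \<epsilon> \<longrightarrow> positive_spectrum G \<and> simple_spectrum G) \<and>
    (\<epsilon> = 0 \<longrightarrow>
           a = b \<and> (0 < \<omega> \<and> \<omega> < 1 / 3 \<longrightarrow> a < 1) \<and> (1 / 3 < \<omega> \<and> \<omega> < 1 / 2 \<longrightarrow> a > 1))"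
proof -
  have eps: "\<epsilon>\<^sup>2 < 1"
    using assms(5,6) by (simp add: abs_square_less_1)
  note h = assms(8) and Keps = ellipticK_pos[OF eps]
  have nq: "\<omega> * of_int n = of_int q" and n: "real_of_int n > 0"
    using assms(1,7) by simp_all
  have \<omega>: "0 < \<omega>" "\<omega> < 1 / 2"
    unfolding assms(7) using assms(2,3) n by (simp_all add: field_simps)
  have cop: "coprime n q"
    using assms(4) by (simp add: coprime_iff_gcd_eq_1 gcd.commute)
  \<comment> \<open>If \<open>j * \<omega>\<close> were an integer, coprimality would make
    \<open>n\<close> divide \<open>j\<close>, impossible for 0 < j < 5 \<le> n. This excludes 1/3
    and 1/4 and also yields \<open>sep\<close>.\<close>
  have \<omega>_ne: "of_int j * \<omega> \<noteq> of_int m" if "0 < j" "j < 5" for j m :: int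
  proof
    assume "of_int j * \<omega> = of_int m"
    then have "of_int j * (\<omega> * of_int n) = of_int m * real_of_int n" by simp
    then have "j * q = m * n" unfolding nq by (simp only: of_int_mult[symmetric] of_int_eq_iff)
    then have "n dvd j" using cop by (metis coprime_dvd_mult_left_iff dvd_triv_right)
    then show False using zdvd_imp_le[of n j] that assms(1) by simp
  qed
  have third: "\<omega> \<noteq> 1 / 3" and quarter: "\<omega> \<noteq> 1 / 4"
    using \<omega>_ne[of 3 1] \<omega>_ne[of 4 1] by auto
  have sep: "\<forall>j \<in> {1..3}. \<forall>m :: int. of_int j * h \<noteq> of_int m * (4 * ellipticK \<epsilon>)"
    using \<omega>_ne Keps by (simp add: h)
  have h_range: "0 < h" "h < 2 * ellipticK \<epsilon>" "h \<noteq> ellipticK \<epsilon>"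
    using \<omega> quarter Keps by (auto simp: h)
  have c: "cn \<epsilon> h \<noteq> 0" "cn \<epsilon> (h / 2) \<noteq> 0"
    using cn_nonzero[OF eps h_range] cn_pos[OF eps, of "h / 2"] h_range by simp_all
  have P_Suc: "P (i + n) = P i" for i
  proof -
    \<comment> \<open>Going through all \<open>n\<close> labels advances the parameter by exactly
      \<open>q\<close> periods.\<close>
    have "u0 + of_int (i + n) * h = u0 + of_int i * h + of_int q * (4 * ellipticK \<epsilon>)"
      using nq by (simp add: h algebra_simps flip: nq)
    then have "circle_vec \<epsilon> (u0 + of_int (i + n) * h) = circle_vec \<epsilon> (u0 + of_int i * h)"
      unfolding circle_vec_eq_iff[OF eps] by blast
    then show ?thesis
      unfolding assms(9) by (simp add: poncelet_polygon_def circle_point_eq_span)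
  qed
  have ngon: "labeled_ngon n P"
    using P_Suc by (simp add: labeled_ngon_def assms(9) poncelet_polygon_def circle_point_RP2)
  have sx: "s_x \<epsilon> h = cd \<epsilon> h / cd \<epsilon> (h / 2)"
    by (simp add: s_x_def cd_def)
  have G: "G = diag3 a b 1"
    unfolding assms(10-13) scaling_def diag3_mult sx
    by (simp add: s_y_def eig_a_def eig_b_def power2_eq_square)
  \<comment> \<open>The image is an invertible transform of a polygon with the same step
    \<open>h\<close>, so the nondegeneracy result applies to it as well.\<close>
  have T_defined: "pentagram_defined (pentagram P)"
    unfolding assms(9) pentagram_poncelet_polygon[OF eps sep c]
      pentagram_defined_act[OF scaling_invertible[OF eps c]]
    by (rule pentagram_poncelet(2)[OF eps sep c])
  \<comment> \<open>After division by \<open>4 * ellipticK \<epsilon>\<close>, the threshold h =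
    4K/3 is \<open>\<omega> = 1 / 3\<close> and h = K is \<open>\<omega> = 1 / 4\<close>.\<close>
  have below: "a < 1" "\<epsilon> \<noteq> 0 \<Longrightarrow> b < a" "0 < b" if "\<omega> < 1 / 3"
    using eig_order_below[OF eps h_range(1) _ h_range(3)] that Keps assms(12,13)
    by (simp_all add: h)
  have above: "\<epsilon> \<noteq> 0 \<Longrightarrow> a < b" "1 < a" if "1 / 3 < \<omega>"
    using eig_order_above[OF eps _ h_range(2)] that Keps assms(12,13)
    by (simp_all add: h)
  have spec: "positive_spectrum G \<and> simple_spectrum G" if "0 < \<epsilon>"
  proof -
    \<comment> \<open>As \<open>\<omega> \<noteq> 1 / 3\<close>, one of the two strict orderings
      holds, and each gives positive and distinct eigenvalues.\<close>
    have "0 < a" "0 < b" "a \<noteq> b" "a \<noteq> 1" "b \<noteq> 1"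
      using below above third that by (cases "\<omega> < 1 / 3"; force)+
    then show ?thesis
      unfolding G by (auto simp: positive_spectrum_def Spec_diag3 intro: simple_spectrum_diag3)
  qed
  have Spec: "Spec G = {1, complex_of_real a, complex_of_real b}"
    unfolding G Spec_diag3 by auto
  have T: "pentagram P i = act S (circle_point \<epsilon> (u0 + (real_of_int i + 3 / 2) * h))" for i
    unfolding assms(9,10) by (rule pentagram_poncelet(1)[OF eps sep c])
  have T2: "pentagram (pentagram P) i = act (S ** S) (P (i + 3))" for i
    unfolding assms(9,10) by (rule pentagram_poncelet_twice[OF eps sep c])
  have lift: "forward_DS_lift P M \<longleftrightarrow> (\<exists>c. c \<noteq> 0 \<and> M = c *\<^sub>R G)" for M
    unfolding assms(9-11) by (rule forward_DS_lift_unique[OF eps sep c])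
  have P_defined: "pentagram_defined P"
    unfolding assms(9) by (rule pentagram_poncelet(2)[OF eps sep c])
  have zero: "a = b" if "\<epsilon> = 0"
    unfolding assms(12,13) that by (rule eig_modulus_0)
  show ?thesis
    using ngon sx P_defined T T_defined T2 lift G Spec below above eig_third[OF eps]
      eig_quarter[OF eps] third quarter spec zero
    by (intro conjI) auto
qed

end
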